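(* For every connected graph $G$ of order $n\ge 3$ and every integer $k$ with $1\le k<\Delta(G)$ one has $\max\{\gamma(G),\lceil \frac{n}{k+1}\rceil\}\le \gamma_k^{\mathrm L}(G)\le n-k$. These bounds are tight, i.e.: (a) there exist a connected graph $G$ of order $n\ge 3$ and an integer $k$ with $1\le k<\Delta(G)$ such that $\gamma_k^{\mathrm L}(G)=\gamma(G)$; (b) there exist a connected graph $G$ of order $n\ge 3$ and an integer $k$ with $1\le k<\Delta(G)$ such that $\gamma_k^{\mathrm L}(G)=\lceil \frac{n}{k+1}\rceil$; (c) there exist a connected graph $G$ of order $n\ge 3$ and an integer $k$ with $1\le k<\Delta(G)$ such that $\gamma_k^{\mathrm L}(G)=n-k$.
   Context: All graphs are finite, simple and undirected; $\Delta(G)$ is the maximum degree and $N(v)$ is the open neighborhood of $v$. A dominating set of $G$ is a set $D\subseteq V(G)$ such that every vertex not in $D$ has a neighbor in $D$; $\gamma(G)$ is the minimum cardinality of a dominating set. For an integer $0\le k\le \Delta(G)$, a set $D\subseteq V(G)$ is a $k$-limited dominating set if $D$ is a dominating set and $|N(u)-D|\le k$ for every $u\in D$. $\gamma_k^{\mathrm L}(G)$ is the minimum cardinality of a $k$-limited dominating set of $G$. *)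

theory Defs
  imports Complex_Main "Graph_Theory.Pair_Digraph" "Graph_Theory.Digraph_Component"
begin

text \<open>
  A finite simple undirected graph is a \<^locale>\<open>pair_graph\<close>: a finite, loopfree, symmetric
  digraph whose arcs are pairs of vertices. Every edge is thus represented by its two
  orientations, so the out-degree of a vertex is its degree in the undirected sense.
\<close>

definition max_degree :: "'a pair_pre_digraph \<Rightarrow> nat" where
  "max_degree G = Max (out_degree (with_proj G) ` pverts G)"

definition nbhd :: "'a pair_pre_digraph \<Rightarrow> 'a \<Rightarrow> 'a set" where
  "nbhd G v = {w. (v, w) \<in> parcs G}"

definition dominating_set :: "'a pair_pre_digraph \<Rightarrow> 'a set \<Rightarrow> bool" where
  "dominating_set G D \<longleftrightarrow>
     D \<subseteq> pverts G \<and> (\<forall>v \<in> pverts G - D. nbhd G v \<inter> D \<noteq> {})"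

definition limited_dominating_set :: "'a pair_pre_digraph \<Rightarrow> nat \<Rightarrow> 'a set \<Rightarrow> bool" where
  "limited_dominating_set G k D \<longleftrightarrow>
     dominating_set G D \<and> (\<forall>u \<in> D. card (nbhd G u - D) \<le> k)"

text \<open>
  For a finite graph the vertex set itself is a $k$-limited dominating set for every $k$, so
  both minima below range over nonempty finite sets.
\<close>

definition domination_number :: "'a pair_pre_digraph \<Rightarrow> nat" where
  "domination_number G = Min (card ` {D. dominating_set G D})"

definition limited_domination_number :: "'a pair_pre_digraph \<Rightarrow> nat \<Rightarrow> nat" where
  "limited_domination_number G k = Min (card ` {D. limited_dominating_set G k D})"

end

theory Submission
  imports Defs
begin

text \<open>
  If a set of vertices \<open>D\<close> dominates and each of its members sees at most \<open>k\<close> vertices outside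
  \<open>D\<close>, then the vertices outside \<open>D\<close> number at most \<open>k * card D\<close>; this gives the lower bound
  \<open>n \<le> (k + 1) * card D\<close>. The bound by the domination number is immediate, since a limited
  dominating set is in particular dominating. For the upper bound, take a vertex \<open>v\<close> of maximum
  degree and remove \<open>k\<close> of its neighbours from the vertex set: the removed vertices are dominated
  by \<open>v\<close>, and as only \<open>k\<close> vertices are missing no remaining vertex can see more than \<open>k\<close> of them.

  Paths with \<open>k = 1\<close> show tightness. On three vertices the lower bound \<open>\<lceil>3/2\<rceil>\<close> and the upper
  bound \<open>3 - 1\<close> coincide, so both are attained. On four vertices the two inner vertices form a
  1-limited dominating set. No single vertex dominates, because a dominating set is always
  \<open>\<Delta>\<close>-limited and the counting bound with \<open>k = \<Delta> = 2\<close> then reads \<open>4 \<le> 3 * card D\<close>. Hence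
  both parameters equal 2.
\<close>

section \<open>Bounds on limited dominating sets\<close>

lemma out_degree_eq_card_nbhd: "out_degree (with_proj G) v = card (nbhd G v)"
proof -
  have "out_arcs (with_proj G) v = Pair v ` nbhd G v"
    by (auto simp: out_arcs_def nbhd_def)
  then show ?thesis
    by (simp add: out_degree_def card_image inj_on_def)
qed

lemma dominating_set_verts: "dominating_set G (pverts G)"
  by (simp add: dominating_set_def)

lemma limited_dominating_setD: "limited_dominating_set G k D \<Longrightarrow> dominating_set G D"
  by (simp add: limited_dominating_set_def)

context pair_fin_digraph
begin

lemma nbhd_subset_verts: "nbhd G v \<subseteq> pverts G"
  by (auto simp: nbhd_def dest: in_arcsD2)

lemma finite_nbhd: "finite (nbhd G v)"
  using nbhd_subset_verts pair_finite_verts by (rule finite_subset)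

lemma limited_dominating_set_verts: "limited_dominating_set G k (pverts G)"
proof -
  have "card (nbhd G u - pverts G) \<le> k" for u
    using nbhd_subset_verts[of u] by (simp add: Diff_eq_empty_iff[THEN iffD2])
  then show ?thesis
    by (simp add: limited_dominating_set_def dominating_set_verts)
qed

lemma finite_dominating_sets: "finite {D. dominating_set G D}"
  by (rule finite_subset[of _ "Pow (pverts G)"])
    (auto simp: dominating_set_def pair_finite_verts)

lemma finite_limited_dominating_sets: "finite {D. limited_dominating_set G k D}"
  using finite_dominating_sets
  by (rule finite_subset[rotated]) (auto dest: limited_dominating_setD)

lemma domination_number_le: "dominating_set G D \<Longrightarrow> domination_number G \<le> card D"
  unfolding domination_number_def by (intro Min_le) (auto simp: finite_dominating_sets)

lemma limited_domination_number_le: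
  "limited_dominating_set G k D \<Longrightarrow> limited_domination_number G k \<le> card D"
  unfolding limited_domination_number_def
  by (intro Min_le) (auto simp: finite_limited_dominating_sets)

lemma domination_number_attained:
  obtains D where "dominating_set G D" "card D = domination_number G"
proof -
  have "domination_number G \<in> card ` {D. dominating_set G D}"
    unfolding domination_number_def using dominating_set_verts
    by (intro Min_in) (auto simp: finite_dominating_sets)
  then show ?thesis
    using that by force
qed

lemma limited_domination_number_attained:
  obtains D where "limited_dominating_set G k D" "card D = limited_domination_number G k"
proof -
  have "limited_domination_number G k \<in> card ` {D. limited_dominating_set G k D}"
    unfolding limited_domination_number_def using limited_dominating_set_verts
    by (intro Min_in) (auto simp: finite_limited_dominating_sets)
  then show ?thesis
    using that by force
qed

lemma domination_number_le_limited_domination_number: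
  "domination_number G \<le> limited_domination_number G k"
  by (metis limited_domination_number_attained limited_dominating_setD domination_number_le)

lemma card_nbhd_le_max_degree: "v \<in> pverts G \<Longrightarrow> card (nbhd G v) \<le> max_degree G"
  unfolding max_degree_def out_degree_eq_card_nbhd
  by (intro Max_ge) (auto simp: pair_finite_verts)

lemma max_degree_attained:
  assumes "pverts G \<noteq> {}"
  obtains v where "v \<in> pverts G" "card (nbhd G v) = max_degree G"
proof -
  have "max_degree G \<in> (\<lambda>v. card (nbhd G v)) ` pverts G"
    unfolding max_degree_def out_degree_eq_card_nbhd
    using assms by (intro Max_in) (auto simp: pair_finite_verts)
  then show ?thesis
    using that by force
qed

text \<open>
  For \<open>k = \<Delta>\<close> the limit is vacuous. This makes every lower bound for limited dominating sets a lower
  bound for ordinary ones.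
\<close>

lemma dominating_set_imp_max_degree_limited:
  assumes "dominating_set G D"
  shows "limited_dominating_set G (max_degree G) D"
proof -
  have "card (nbhd G u - D) \<le> max_degree G" if "u \<in> D" for u
  proof -
    have "u \<in> pverts G"
      using assms that by (auto simp: dominating_set_def)
    moreover have "card (nbhd G u - D) \<le> card (nbhd G u)"
      by (simp add: card_mono finite_nbhd)
    ultimately show ?thesis
      using card_nbhd_le_max_degree by fastforce
  qed
  then show ?thesis
    using assms by (simp add: limited_dominating_set_def)
qed

end

context pair_graph
begin

text \<open>
  Each vertex of \<open>D\<close> accounts for itself and at most \<open>k\<close> vertices outside \<open>D\<close>, and by domination
  every vertex is accounted for.
\<close>

lemma card_verts_le_limited_dominating_set:
  assumes "limited_dominating_set G k D"
  shows "card (pverts G) \<le> card D * (k + 1)"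
proof -
  have dom: "D \<subseteq> pverts G" "\<And>v. v \<in> pverts G - D \<Longrightarrow> nbhd G v \<inter> D \<noteq> {}"
    and lim: "\<And>u. u \<in> D \<Longrightarrow> card (nbhd G u - D) \<le> k"
    using assms by (auto simp: limited_dominating_set_def dominating_set_def)
  have fin: "finite D"
    using dom(1) pair_finite_verts by (rule finite_subset)
  have "pverts G \<subseteq> D \<union> (\<Union>u\<in>D. nbhd G u - D)"
  proof
    fix v assume v: "v \<in> pverts G"
    show "v \<in> D \<union> (\<Union>u\<in>D. nbhd G u - D)"
    proof (cases "v \<in> D")
      case False
      then obtain u where u: "u \<in> D" "(v, u) \<in> parcs G"
        using dom(2)[of v] v by (auto simp: nbhd_def)
      then have "(u, v) \<in> parcs G"
        using arcs_symmetric by blast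
      then show ?thesis
        using u False by (auto simp: nbhd_def)
    qed simp
  qed
  then have "card (pverts G) \<le> card (D \<union> (\<Union>u\<in>D. nbhd G u - D))"
    using fin finite_nbhd by (intro card_mono) auto
  also have "\<dots> \<le> card D + card (\<Union>u\<in>D. nbhd G u - D)"
    by (rule card_Un_le)
  also have "\<dots> \<le> card D + (\<Sum>u\<in>D. card (nbhd G u - D))"
    using card_UN_le[OF fin] by (rule add_left_mono)
  also have "\<dots> \<le> card D + card D * k"
    using sum_bounded_above[of D "\<lambda>u. card (nbhd G u - D)" k] lim by simp
  finally show ?thesis
    by simp
qed

lemma ceiling_le_limited_domination_number:
  "\<lceil>real (card (pverts G)) / real (k + 1)\<rceil> \<le> int (limited_domination_number G k)"
proof -
  obtain D where D: "limited_dominating_set G k D" "card D = limited_domination_number G k"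
    by (rule limited_domination_number_attained)
  have "real (card (pverts G)) \<le> real (limited_domination_number G k * (k + 1))"
    using card_verts_le_limited_dominating_set[OF D(1)] D(2) by (simp only: of_nat_le_iff)
  then have "real (card (pverts G)) / real (k + 1) \<le> real (limited_domination_number G k)"
    by (simp only: of_nat_mult pos_divide_le_eq of_nat_0_less_iff)
  then show ?thesis
    by (simp add: ceiling_le_iff)
qed

text \<open>
  The complement of \<open>k\<close> neighbours of a vertex of maximum degree is \<open>k\<close>-limited dominating. The
  second conclusion lets the truncated difference be read as one of integers.
\<close>

lemma limited_domination_number_le_card_diff:
  assumes "pverts G \<noteq> {}" "k \<le> max_degree G"
  shows "limited_domination_number G k \<le> card (pverts G) - k" "k \<le> card (pverts G)"
proof -
  obtain v where v: "v \<in> pverts G" "card (nbhd G v) = max_degree G"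
    using assms(1) by (rule max_degree_attained)
  obtain K where K: "K \<subseteq> nbhd G v" "card K = k" "finite K"
    using obtain_subset_with_card_n[of k "nbhd G v"] v(2) assms(2) by metis
  have sub: "K \<subseteq> pverts G"
    using K(1) nbhd_subset_verts by blast
  \<comment> \<open>As there are no loops, \<open>v\<close> itself stays and dominates all of \<open>K\<close>.\<close>
  have "v \<notin> K"
    using K(1) no_loops' by (auto simp: nbhd_def)
  then have "dominating_set G (pverts G - K)"
    using K(1) v(1) arcs_symmetric by (fastforce simp: dominating_set_def nbhd_def)
  moreover have "card (nbhd G u - (pverts G - K)) \<le> k" for u
    using card_mono[OF K(3), of "nbhd G u - (pverts G - K)"] K(2) nbhd_subset_verts[of u] by blast
  ultimately have "limited_dominating_set G k (pverts G - K)"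
    by (simp add: limited_dominating_set_def)
  then have "limited_domination_number G k \<le> card (pverts G - K)"
    by (rule limited_domination_number_le)
  then show "limited_domination_number G k \<le> card (pverts G) - k"
    using K sub by (simp add: card_Diff_subset)
  show "k \<le> card (pverts G)"
    using card_mono[OF pair_finite_verts sub] K(2) by simp
qed

lemma limited_domination_number_bounds:
  assumes "pverts G \<noteq> {}" "k \<le> max_degree G"
  shows "max (int (domination_number G)) \<lceil>real (card (pverts G)) / real (k + 1)\<rceil>
      \<le> int (limited_domination_number G k)"
    and "int (limited_domination_number G k) \<le> int (card (pverts G)) - int k"
  using domination_number_le_limited_domination_number[of k]
    ceiling_le_limited_domination_number[of k] limited_domination_number_le_card_diff[OF assms]
  by (simp_all add: le_diff_conv2)

lemma card_verts_le_domination_number: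
  "card (pverts G) \<le> domination_number G * (max_degree G + 1)"
  by (metis domination_number_attained dominating_set_imp_max_degree_limited
      card_verts_le_limited_dominating_set)

end

section \<open>Paths\<close>

definition path_graph :: "nat \<Rightarrow> nat pair_pre_digraph" where
  "path_graph n = \<lparr> pverts = {..<n},
     parcs = {(i, j). i < n \<and> j < n \<and> (j = Suc i \<or> i = Suc j)} \<rparr>"

lemma verts_path_graph [simp]: "pverts (path_graph n) = {..<n}"
  by (simp add: path_graph_def)

lemma arcs_path_graph [simp]:
  "(i, j) \<in> parcs (path_graph n) \<longleftrightarrow> i < n \<and> j < n \<and> (j = Suc i \<or> i = Suc j)"
  by (simp add: path_graph_def)

lemma pair_graph_path_graph: "pair_graph (path_graph n)"
proof
  show "finite (parcs (path_graph n))"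
    by (rule finite_subset[of _ "{..<n} \<times> {..<n}"]) auto
  show "symmetric (with_proj (path_graph n))"
    by (auto simp: symmetric_def sym_def)
qed auto

lemma connected_path_graph:
  assumes "n > 0"
  shows "Digraph_Component.connected (with_proj (path_graph n))"
proof -
  interpret pair_graph "path_graph n"
    by (rule pair_graph_path_graph)
  have from_0: "0 \<rightarrow>\<^sup>*\<^bsub>with_proj (path_graph n)\<^esub> i" if "i < n" for i
    using that
  proof (induction i)
    case (Suc i)
    then have "i \<rightarrow>\<^bsub>with_proj (path_graph n)\<^esub> Suc i"
      by simp
    with Suc show ?case
      using reachable_adj_trans by simp
  qed simp
  have "strongly_connected (with_proj (path_graph n))"
  proof (rule strongly_connectedI)
    fix i j assume "i \<in> verts (with_proj (path_graph n))" "j \<in> verts (with_proj (path_graph n))"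
    then show "i \<rightarrow>\<^sup>*\<^bsub>with_proj (path_graph n)\<^esub> j"
      using from_0 symmetric_reachable' reachable_trans
      by (metis lessThan_iff verts_path_graph with_proj_simps(1))
  qed (use assms in auto)
  moreover have "mk_symmetric (with_proj (path_graph n)) = path_graph n"
    by (auto simp: mk_symmetric_def path_graph_def)
  ultimately show ?thesis
    by (simp add: Digraph_Component.connected_def)
qed

lemma max_degree_path_graph:
  assumes "n \<ge> 3"
  shows "max_degree (path_graph n) = 2"
proof (rule antisym)
  interpret pair_graph "path_graph n"
    by (rule pair_graph_path_graph)
  have "nbhd (path_graph n) 1 = {0, 2}"
    using assms by (auto simp: nbhd_def)
  then show "2 \<le> max_degree (path_graph n)"
    using card_nbhd_le_max_degree[of 1] assms by simp
  obtain v where v: "card (nbhd (path_graph n) v) = max_degree (path_graph n)"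
    using assms by (metis max_degree_attained verts_path_graph lessThan_empty_iff
        not_numeral_le_zero)
  \<comment> \<open>At the end \<open>v = 0\<close> truncation only adds \<open>0\<close> itself, so the inclusion still holds.\<close>
  have "nbhd (path_graph n) v \<subseteq> {v - 1, Suc v}"
    by (auto simp: nbhd_def)
  then have "card (nbhd (path_graph n) v) \<le> card {v - 1, Suc v}"
    by (intro card_mono) auto
  also have "\<dots> \<le> 2"
    by (simp add: card_insert_if)
  finally show "max_degree (path_graph n) \<le> 2"
    using v by simp
qed

text \<open>The lower bound \<open>\<lceil>3/2\<rceil>\<close> meets the upper bound \<open>3 - 1\<close>.\<close>

lemma limited_domination_number_path_graph_3: "limited_domination_number (path_graph 3) 1 = 2"
proof -
  interpret pair_graph "path_graph 3"
    by (rule pair_graph_path_graph)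
  have "\<lceil>3 / 2 :: real\<rceil> = 2"
    by (simp add: ceiling_eq_iff)
  then show ?thesis
    using limited_domination_number_bounds[of 1]
    by (simp add: max_degree_path_graph lessThan_empty_iff)
qed

text \<open>
  Both numbers equal 2: the two inner vertices are 1-limited dominating, and one vertex of degree
  at most 2 cannot dominate four vertices.
\<close>

lemma limited_domination_number_path_graph_4:
  "limited_domination_number (path_graph 4) 1 = domination_number (path_graph 4)"
proof -
  interpret pair_graph "path_graph 4"
    by (rule pair_graph_path_graph)
  have "nbhd (path_graph 4) 1 - {1, 2} = {0}" "nbhd (path_graph 4) 2 - {1, 2} = {3}"
    "1 \<in> nbhd (path_graph 4) 0" "2 \<in> nbhd (path_graph 4) 3"
    by (auto simp: nbhd_def)
  moreover have "pverts (path_graph 4) - {1, 2} = {0, 3}"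
    by auto
  ultimately have "limited_dominating_set (path_graph 4) 1 {1, 2}"
    unfolding limited_dominating_set_def dominating_set_def by auto
  then have "limited_domination_number (path_graph 4) 1 \<le> 2"
    using limited_domination_number_le by fastforce
  moreover have "2 \<le> domination_number (path_graph 4)"
    using card_verts_le_domination_number by (simp add: max_degree_path_graph)
  ultimately show ?thesis
    using domination_number_le_limited_domination_number[of 1] by simp
qed

section \<open>The bounds and their tightness\<close>

theorem corollary5:
  shows
    "(\<forall>(G :: 'a pair_pre_digraph) (k :: nat).
        pair_graph G \<and> Digraph_Component.connected (with_proj G) \<and> card (pverts G) \<ge> 3
          \<and> 1 \<le> k \<and> k < max_degree G \<longrightarrow>
        max (int (domination_number G)) \<lceil>real (card (pverts G)) / real (k + 1)\<rceil>
          \<le> int (limited_domination_number G k)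
        \<and> int (limited_domination_number G k) \<le> int (card (pverts G)) - int k)
     \<and> (\<exists>(G :: nat pair_pre_digraph) (k :: nat).
          pair_graph G \<and> Digraph_Component.connected (with_proj G) \<and> card (pverts G) \<ge> 3
            \<and> 1 \<le> k \<and> k < max_degree G
            \<and> limited_domination_number G k = domination_number G)
     \<and> (\<exists>(G :: nat pair_pre_digraph) (k :: nat).
          pair_graph G \<and> Digraph_Component.connected (with_proj G) \<and> card (pverts G) \<ge> 3
            \<and> 1 \<le> k \<and> k < max_degree G
            \<and> int (limited_domination_number G k)
                = \<lceil>real (card (pverts G)) / real (k + 1)\<rceil>)
     \<and> (\<exists>(G :: nat pair_pre_digraph) (k :: nat).
          pair_graph G \<and> Digraph_Component.connected (with_proj G) \<and> card (pverts G) \<ge> 3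
            \<and> 1 \<le> k \<and> k < max_degree G
            \<and> int (limited_domination_number G k) = int (card (pverts G)) - int k)"
proof (intro conjI)
  show "\<forall>(G :: 'a pair_pre_digraph) k.
      pair_graph G \<and> Digraph_Component.connected (with_proj G) \<and> card (pverts G) \<ge> 3
        \<and> 1 \<le> k \<and> k < max_degree G \<longrightarrow>
      max (int (domination_number G)) \<lceil>real (card (pverts G)) / real (k + 1)\<rceil>
        \<le> int (limited_domination_number G k)
      \<and> int (limited_domination_number G k) \<le> int (card (pverts G)) - int k"
  proof (intro allI impI)
    fix G :: "'a pair_pre_digraph" and k :: nat
    assume G: "pair_graph G \<and> Digraph_Component.connected (with_proj G) \<and> card (pverts G) \<ge> 3
        \<and> 1 \<le> k \<and> k < max_degree G"
    then have "pverts G \<noteq> {}"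
      by auto
    with G show "max (int (domination_number G)) \<lceil>real (card (pverts G)) / real (k + 1)\<rceil>
        \<le> int (limited_domination_number G k)
      \<and> int (limited_domination_number G k) \<le> int (card (pverts G)) - int k"
      using pair_graph.limited_domination_number_bounds[of G k] by simp
  qed
next
  show "\<exists>(G :: nat pair_pre_digraph) k.
      pair_graph G \<and> Digraph_Component.connected (with_proj G) \<and> card (pverts G) \<ge> 3
        \<and> 1 \<le> k \<and> k < max_degree G
        \<and> limited_domination_number G k = domination_number G"
    by (intro exI[of _ "path_graph 4"] exI[of _ 1])
      (simp add: pair_graph_path_graph connected_path_graph max_degree_path_graph
        limited_domination_number_path_graph_4[simplified])
next
  have "\<lceil>3 / 2 :: real\<rceil> = 2"
    by (simp add: ceiling_eq_iff)
  then show "\<exists>(G :: nat pair_pre_digraph) k.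
      pair_graph G \<and> Digraph_Component.connected (with_proj G) \<and> card (pverts G) \<ge> 3
        \<and> 1 \<le> k \<and> k < max_degree G
        \<and> int (limited_domination_number G k) = \<lceil>real (card (pverts G)) / real (k + 1)\<rceil>"
    by (intro exI[of _ "path_graph 3"] exI[of _ 1])
      (simp add: pair_graph_path_graph connected_path_graph max_degree_path_graph
        limited_domination_number_path_graph_3[simplified])
next
  show "\<exists>(G :: nat pair_pre_digraph) k.
      pair_graph G \<and> Digraph_Component.connected (with_proj G) \<and> card (pverts G) \<ge> 3
        \<and> 1 \<le> k \<and> k < max_degree G
        \<and> int (limited_domination_number G k) = int (card (pverts G)) - int k"
    by (intro exI[of _ "path_graph 3"] exI[of _ 1])
      (simp add: pair_graph_path_graph connected_path_graph max_degree_path_graph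
        limited_domination_number_path_graph_3[simplified])
qed

end
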